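(* For $n\ge 1$ let $R_n(x)=\sum_{\sigma\in\mathcal{S}_n} x^{\overleftarrow{des}_E(\sigma)}$. Then (1) $R_1(x)=1$ and $R_2(x)=1+x$; (2) for all $n\ge 1$, $R_{2n+1}(x)=\Delta_{2n}(R_{2n}(x))$; (3) for all $n\ge 1$, $R_{2n+2}(x)=\Gamma_{2n+1}(R_{2n+1}(x))$, where $\Delta_{2n}$ is the linear operator on polynomials in $x$ sending $x^k$ to $k x^{k-1}+(2n+1-k)x^k$, and $\Gamma_{2n+1}$ is the linear operator sending $x^k$ to $(k+1)x^k+(2n+1-k)x^{k+1}$.
   Context: $\mathcal{S}_n$ denotes the set of permutations $\sigma=\sigma_1\sigma_2\cdots\sigma_n$ of $\{1,\dots,n\}$. For such $\sigma$, $\overleftarrow{des}_E(\sigma)$ is the number of indices $i\in\{1,\dots,n-1\}$ such that $\sigma_i>\sigma_{i+1}$ and $\sigma_i$ is even. *)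

theory Defs
  imports "HOL-Combinatorics.Permutations" "HOL-Computational_Algebra.Polynomial"
begin

text \<open>A permutation \<open>\<sigma>\<close> of \<open>{1..n}\<close> is a function with \<open>\<sigma> permutes {1..n}\<close>; the word
  notation \<open>\<sigma>\<^sub>i\<close> is \<open>\<sigma> i\<close>.\<close>

definition desE :: "nat \<Rightarrow> (nat \<Rightarrow> nat) \<Rightarrow> nat" where
  "desE n \<sigma> = card {i \<in> {1..n - 1}. \<sigma> i > \<sigma> (i + 1) \<and> even (\<sigma> i)}"

definition R :: "nat \<Rightarrow> 'a::comm_ring_1 poly" where
  "R n = (\<Sum>\<sigma> | \<sigma> permutes {1..n}. monom 1 (desE n \<sigma>))"

definition lin_ext :: "(nat \<Rightarrow> 'a::comm_ring_1 poly) \<Rightarrow> 'a poly \<Rightarrow> 'a poly" where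
  "lin_ext f p = (\<Sum>k\<le>degree p. smult (coeff p k) (f k))"

text \<open>At \<open>k = 0\<close> the truncated exponent \<open>k - 1\<close> is harmless, as its coefficient \<open>k\<close> vanishes. The
  coefficients \<open>m + 1 - k\<close> and \<open>m - k\<close> are differences in the ring and may be negative.\<close>

definition Delta :: "nat \<Rightarrow> 'a::comm_ring_1 poly \<Rightarrow> 'a poly" where
  "Delta m = lin_ext (\<lambda>k. monom (of_nat k) (k - 1) + monom (of_nat (m + 1) - of_nat k) k)"

definition Gamma :: "nat \<Rightarrow> 'a::comm_ring_1 poly \<Rightarrow> 'a poly" where
  "Gamma m = lin_ext (\<lambda>k. monom (of_nat (k + 1)) k + monom (of_nat m - of_nat k) (k + 1))"

lemma lin_ext_bound:
  assumes "degree p \<le> N"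
  shows "lin_ext f p = (\<Sum>k\<le>N. smult (coeff p k) (f k))"
  unfolding lin_ext_def
  by (rule sum.mono_neutral_left) (use assms in \<open>auto simp: coeff_eq_0\<close>)

lemma lin_ext_add: "lin_ext f (p + q) = lin_ext f p + lin_ext f q"
proof -
  define N where "N = max (degree p) (degree q)"
  have "degree (p + q) \<le> N" "degree p \<le> N" "degree q \<le> N"
    by (auto simp: N_def degree_add_le_max)
  then show ?thesis
    by (simp add: lin_ext_bound[where N = N] smult_add_left sum.distrib)
qed

lemma lin_ext_smult: "lin_ext f (smult c p) = smult c (lin_ext f p)"
  by (rule poly_eqI)
    (simp add: lin_ext_bound[where N = "degree p"] degree_smult_le coeff_sum sum_distrib_left mult.assoc)

lemma lin_ext_monom: "lin_ext f (monom 1 k) = f k"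
proof -
  have "lin_ext f (monom 1 k) = (\<Sum>j\<le>k. if k = j then f j else 0)"
    unfolding lin_ext_bound[OF degree_monom_le] by (rule sum.cong) auto
  then show ?thesis by simp
qed

lemma Delta_linear:
  "Delta m (p + q) = Delta m p + Delta m q"
  "Delta m (smult c p) = smult c (Delta m p)"
  by (simp_all add: Delta_def lin_ext_add lin_ext_smult)

lemma Delta_monom:
  "Delta m (monom 1 k) = monom (of_nat k) (k - 1) + monom (of_nat (m + 1) - of_nat k) k"
  by (simp add: Delta_def lin_ext_monom)

lemma Gamma_linear:
  "Gamma m (p + q) = Gamma m p + Gamma m q"
  "Gamma m (smult c p) = smult c (Gamma m p)"
  by (simp_all add: Gamma_def lin_ext_add lin_ext_smult)

lemma Gamma_monom:
  "Gamma m (monom 1 k) = monom (of_nat (k + 1)) k + monom (of_nat m - of_nat k) (k + 1)"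
  by (simp add: Gamma_def lin_ext_monom)

end

theory Submission imports Defs begin

text \<open>Every permutation of \<open>{1..n + 1}\<close> arises exactly once by inserting the letter \<open>n + 1\<close> into the
  word of a permutation of \<open>{1..n}\<close>. Being maximal, the new letter destroys the even descent
  at its insertion point, if there is one, and it creates a descent unless it is put last; that
  descent counts precisely when \<open>n + 1\<close> is even. Summing over the \<open>n + 1\<close> insertion points of a
  word with \<open>k\<close> even descents yields the images of \<open>x\<^sup>k\<close> under the two operators.\<close>

definition even_descents :: "nat \<Rightarrow> (nat \<Rightarrow> nat) \<Rightarrow> nat set" where
  "even_descents n \<sigma> = {i \<in> {1..n - 1}. \<sigma> i > \<sigma> (i + 1) \<and> even (\<sigma> i)}"

lemma desE_eq_card: "desE n \<sigma> = card (even_descents n \<sigma>)"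
  by (simp add: desE_def even_descents_def)

lemma finite_even_descents [simp]: "finite (even_descents n \<sigma>)"
  by (simp add: even_descents_def)

text \<open>Precomposing the word of a permutation of \<open>{1..m - 1}\<close> with this cycle inserts the letter
  \<open>m\<close> at position \<open>p\<close>.\<close>

definition insertion_cycle :: "nat \<Rightarrow> nat \<Rightarrow> nat \<Rightarrow> nat" where
  "insertion_cycle m p i = (if i < p \<or> m < i then i else if i = p then m else i - 1)"

lemma insertion_cycle_permutes:
  assumes "p \<in> {1..m}"
  shows "insertion_cycle m p permutes {1..m}"
proof (rule bij_imp_permutes)
  show "bij_betw (insertion_cycle m p) {1..m} {1..m}"
    \<comment> \<open>The witness is the inverse cycle: it sends \<open>m\<close> back to
      \<open>p\<close> and shifts \<open>p\<close>, ..., \<open>m - 1\<close> up by one.\<close>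
    by (rule bij_betw_byWitness[where f' = "\<lambda>i. if i < p then i else if i = m then p else i + 1"])
      (use assms in \<open>auto simp: insertion_cycle_def\<close>)
qed (use assms in \<open>auto simp: insertion_cycle_def\<close>)

text \<open>The position of the letter \<open>Suc n\<close> recovers \<open>p\<close>, and the
  cycle, being surjective, can then be cancelled on the right; this gives injectivity. Surjectivity
  follows by counting, since (n + 1) n! = (n + 1)!.\<close>

lemma bij_betw_insertion:
  "bij_betw (\<lambda>(\<sigma>, p). \<sigma> \<circ> insertion_cycle (Suc n) p)
     ({\<sigma>. \<sigma> permutes {1..n}} \<times> {1..Suc n}) {\<sigma>. \<sigma> permutes {1..Suc n}}"
proof -
  let ?f = "\<lambda>(\<sigma>, p). \<sigma> \<circ> insertion_cycle (Suc n) p"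
  let ?A = "{\<sigma>. \<sigma> permutes {1..n}} \<times> {1..Suc n}"
  have "inj_on ?f ?A"
  proof (rule inj_onI, clarify)
    fix \<sigma> \<tau> p q
    assume \<sigma>: "\<sigma> permutes {1..n}" and \<tau>: "\<tau> permutes {1..n}"
      and p: "p \<in> {1..Suc n}" and q: "q \<in> {1..Suc n}"
      and eq: "\<sigma> \<circ> insertion_cycle (Suc n) p = \<tau> \<circ> insertion_cycle (Suc n) q"
    have top: "\<sigma> (Suc n) = Suc n" "\<tau> (Suc n) = Suc n"
      using \<sigma> \<tau> by (auto simp: permutes_def)
    have "\<tau> (insertion_cycle (Suc n) q p) = \<sigma> (insertion_cycle (Suc n) p p)"
      using fun_cong[OF eq, of p] by simp
    also have "\<dots> = \<tau> (Suc n)"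
      using p top by (simp add: insertion_cycle_def)
    finally have "insertion_cycle (Suc n) q p = Suc n"
      using permutes_inj[OF \<tau>] by (simp add: inj_eq)
    then have "p = q"
      using p q by (auto simp: insertion_cycle_def split: if_splits)
    moreover have "surj (insertion_cycle (Suc n) p)"
      by (rule permutes_surj[OF insertion_cycle_permutes[OF p]])
    ultimately show "\<sigma> = \<tau> \<and> p = q"
      using eq by (metis fun.map_comp surj_iff comp_id)
  qed
  moreover have "?f ` ?A \<subseteq> {\<sigma>. \<sigma> permutes {1..Suc n}}"
    by (auto intro!: permutes_compose insertion_cycle_permutes[unfolded One_nat_def]
        elim!: permutes_subset)
  moreover have "card ?A = card {\<sigma>. \<sigma> permutes {1..Suc n}}"
    by (simp add: card_cartesian_product card_permutations[OF refl] del: One_nat_def)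
  moreover have "finite {\<sigma>. \<sigma> permutes {1..Suc n}}"
    by (simp add: finite_permutations)
  ultimately show ?thesis
    by (metis (no_types, lifting) bij_betw_def card_image card_subset_eq)
qed

text \<open>Pairs of neighbours left of the new letter keep their position, those right of it move
  by one. The pair at \<open>p - 1\<close> and \<open>p\<close> is split: position
  \<open>p - 1\<close> now precedes the largest letter, so it is no descent, while \<open>p\<close>
  is one unless it is last.\<close>

lemma even_descents_insertion:
  assumes \<sigma>: "\<sigma> permutes {1..n}" and p: "p \<in> {1..Suc n}"
  shows "even_descents (Suc n) (\<sigma> \<circ> insertion_cycle (Suc n) p) =
    {i \<in> even_descents n \<sigma>. i + 1 < p} \<union> Suc ` {i \<in> even_descents n \<sigma>. p \<le> i} \<union>
    (if even (Suc n) \<and> p \<le> n then {p} else {})" (is "?L = ?R")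
proof (rule set_eqI)
  fix i
  have top: "\<sigma> (Suc n) = Suc n"
    using \<sigma> by (auto simp: permutes_def)
  have le: "\<sigma> j \<le> n" if "1 \<le> j" "j \<le> n" for j
    using permutes_in_image[OF \<sigma>, of j] that by auto
  \<comment> \<open>Positions out of range, then those before the new letter with an unchanged
    neighbour, just before it, at it, and after it.\<close>
  consider "i = 0 \<or> n < i" | "1 \<le> i" "i + 1 < p" "i \<le> n" | "1 \<le> i" "i + 1 = p" "i \<le> n"
    | "1 \<le> i" "i = p" "i \<le> n" | "p < i" "i \<le> n"
    by linarith
  then show "i \<in> ?L \<longleftrightarrow> i \<in> ?R"
  proof cases
    case 1
    then show ?thesis
      using p by (auto simp: even_descents_def)
  next
    case 2
    then show ?thesis
      using p by (auto simp: even_descents_def insertion_cycle_def)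
  next
    case 3
    then show ?thesis
      using p top le[of i] by (auto simp: even_descents_def insertion_cycle_def)
  next
    case 4
    then show ?thesis
      using p top le[of i] by (auto simp: even_descents_def insertion_cycle_def)
  next
    case 5
    then obtain j where "i = Suc j" "p \<le> j" "j < n"
      by (cases i) auto
    then show ?thesis
      using p by (auto simp: even_descents_def insertion_cycle_def)
  qed
qed

lemma desE_insertion:
  assumes \<sigma>: "\<sigma> permutes {1..n}" and p: "p \<in> {1..Suc n}"
  shows "desE (Suc n) (\<sigma> \<circ> insertion_cycle (Suc n) p) =
    card (even_descents n \<sigma> - {p - 1}) + (if even (Suc n) \<and> p \<le> n then 1 else 0)"
proof -
  let ?D = "even_descents n \<sigma>"
  let ?A = "{i \<in> ?D. i + 1 < p}" and ?B = "{i \<in> ?D. p \<le> i}"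
  let ?C = "if even (Suc n) \<and> p \<le> n then {p} else {}"
  have "card (?A \<union> Suc ` ?B \<union> ?C) = card (?A \<union> Suc ` ?B) + card ?C"
    by (rule card_Un_disjoint) auto
  also have "card (?A \<union> Suc ` ?B) = card ?A + card (Suc ` ?B)"
    by (rule card_Un_disjoint) auto
  also have "card (Suc ` ?B) = card ?B"
    by (simp add: card_image)
  also have "card ?A + card ?B = card (?A \<union> ?B)"
    by (rule card_Un_disjoint[symmetric]) auto
  \<comment> \<open>For \<open>p = 1\<close> the removed element is 0, which is never a descent
    position, so insertion in front destroys nothing.\<close>
  also have "?A \<union> ?B = ?D - {p - 1}"
    using p by auto
  finally show ?thesis
    by (simp add: desE_eq_card even_descents_insertion[OF assms])
qed

text \<open>The index \<open>j = p - 1\<close> is the number of old letters before the new one: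
  \<open>j = 0\<close> is the front and \<open>j = n\<close> the end of the word.\<close>

lemma R_Suc:
  "(R (Suc n) :: 'a::comm_ring_1 poly) = (\<Sum>\<sigma> | \<sigma> permutes {1..n}. \<Sum>j\<le>n.
     monom 1 (card (even_descents n \<sigma> - {j}) + (if even (Suc n) \<and> j < n then 1 else 0)))"
proof -
  have "(R (Suc n) :: 'a poly) =
      (\<Sum>(\<sigma>, p) \<in> {\<sigma>. \<sigma> permutes {1..n}} \<times> {1..Suc n}.
         monom 1 (desE (Suc n) (\<sigma> \<circ> insertion_cycle (Suc n) p)))"
    unfolding R_def by (subst sum.reindex_bij_betw[OF bij_betw_insertion, symmetric])
      (simp add: case_prod_unfold)
  also have "\<dots> = (\<Sum>\<sigma> | \<sigma> permutes {1..n}. \<Sum>p=1..Suc n.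
       monom 1 (card (even_descents n \<sigma> - {p - 1}) + (if even (Suc n) \<and> p \<le> n then 1 else 0)))"
    by (simp add: sum.cartesian_product[symmetric] desE_insertion del: One_nat_def)
  also have "\<dots> = (\<Sum>\<sigma> | \<sigma> permutes {1..n}. \<Sum>j\<le>n.
       monom 1 (card (even_descents n \<sigma> - {j}) + (if even (Suc n) \<and> j < n then 1 else 0)))"
    by (intro sum.cong refl sum.reindex_bij_witness[where i = Suc and j = "\<lambda>p. p - 1"]) auto
  finally show ?thesis .
qed

text \<open>The difference is taken in the ring, to match the coefficients of \<open>Delta\<close>
  and \<open>Gamma\<close>.\<close>

lemma sum_split_const:
  fixes a b :: "'a::comm_ring_1 poly"
  assumes "finite S" "D \<subseteq> S"
  shows "(\<Sum>j\<in>S. if j \<in> D then a else b) = of_nat (card D) * a + (of_nat (card S) - of_nat (card D)) * b"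
proof -
  have "(\<Sum>j\<in>S. if j \<in> D then a else b) = (\<Sum>j\<in>D. a) + (\<Sum>j\<in>S - D. b)"
    using assms by (subst sum.subset_diff[of D S]) (auto intro!: arg_cong2[where f = plus] sum.cong)
  also have "(\<Sum>j\<in>S - D. b) = (of_nat (card S) - of_nat (card D)) * b"
    using assms by (simp add: card_Diff_subset finite_subset of_nat_diff card_mono)
  finally show ?thesis
    by simp
qed

lemma of_nat_mult_monom: "of_nat c * monom 1 k = monom (of_nat c :: 'a::comm_ring_1) k"
  by (simp add: of_nat_poly smult_monom)

text \<open>The new letter is odd and creates no even descent. With \<open>k\<close> old ones,
  \<open>k\<close> insertion points lower the exponent by one and the other \<open>n + 1 - k\<close>
  keep it.\<close>

lemma sum_insertions_odd:
  assumes "even n"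
  shows "(\<Sum>j\<le>n. monom 1 (card (even_descents n \<sigma> - {j}) + (if even (Suc n) \<and> j < n then 1 else 0)))
    = (Delta n (monom 1 (desE n \<sigma>)) :: 'a::comm_ring_1 poly)"
proof -
  let ?D = "even_descents n \<sigma>" and ?k = "desE n \<sigma>"
  have "(\<Sum>j\<le>n. monom 1 (card (?D - {j}) + (if even (Suc n) \<and> j < n then 1 else 0)))
      = (\<Sum>j\<le>n. if j \<in> ?D then monom 1 (?k - 1) else monom (1::'a) ?k)"
    using assms by (intro sum.cong refl) (auto simp: desE_eq_card)
  also have "\<dots> = of_nat ?k * monom 1 (?k - 1) + (of_nat (card {..n}) - of_nat ?k) * monom 1 ?k"
    unfolding desE_eq_card by (rule sum_split_const) (auto simp: even_descents_def)
  also have "\<dots> = Delta n (monom 1 ?k)"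
    by (simp only: Delta_monom left_diff_distrib of_nat_mult_monom diff_monom[symmetric] card_atMost
        Suc_eq_plus1)
  finally show ?thesis .
qed

text \<open>The new letter is even. Insertion at the end keeps the exponent \<open>k\<close>. Of the
  other \<open>n\<close> insertion points, \<open>k\<close> trade an old even descent for the new
  one, and \<open>n - k\<close> raise the exponent by one.\<close>

lemma sum_insertions_even:
  assumes "odd n"
  shows "(\<Sum>j\<le>n. monom 1 (card (even_descents n \<sigma> - {j}) + (if even (Suc n) \<and> j < n then 1 else 0)))
    = (Gamma n (monom 1 (desE n \<sigma>)) :: 'a::comm_ring_1 poly)"
proof -
  let ?D = "even_descents n \<sigma>" and ?k = "desE n \<sigma>"
  \<comment> \<open>Hence the term \<open>j = n\<close>, insertion at the end, loses no
    descent.\<close>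
  have n: "n \<notin> ?D"
    using assms by (cases n) (auto simp: even_descents_def)
  have k: "?k = Suc (card (?D - {j}))" if "j \<in> ?D" for j
    unfolding desE_eq_card by (rule card.remove) (use that in auto)
  have "(\<Sum>j\<le>n. monom 1 (card (?D - {j}) + (if even (Suc n) \<and> j < n then 1 else 0)))
      = (\<Sum>j<n. monom 1 (card (?D - {j}) + 1)) + monom (1::'a) ?k"
    using assms n by (simp add: lessThan_Suc_atMost[symmetric] desE_eq_card)
  also have "(\<Sum>j<n. monom 1 (card (?D - {j}) + 1))
      = (\<Sum>j<n. if j \<in> ?D then monom 1 ?k else monom (1::'a) (?k + 1))"
    by (intro sum.cong refl) (auto simp: k, simp add: desE_eq_card)
  also have "\<dots> = of_nat ?k * monom 1 ?k + (of_nat (card {..<n}) - of_nat ?k) * monom 1 (?k + 1)"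
    unfolding desE_eq_card by (rule sum_split_const) (auto simp: even_descents_def)
  also have "\<dots> + monom 1 ?k
      = of_nat (?k + 1) * monom 1 ?k + (of_nat n - of_nat ?k) * monom 1 (?k + 1)"
    by (simp add: algebra_simps)
  also have "\<dots> = Gamma n (monom 1 ?k)"
    by (simp only: Gamma_monom left_diff_distrib of_nat_mult_monom diff_monom[symmetric])
  finally show ?thesis .
qed

text \<open>This moves the operators out of the sum over permutations that defines
  \<open>R\<close>.\<close>

lemma lin_ext_sum: "lin_ext f (\<Sum>x\<in>A. p x) = (\<Sum>x\<in>A. lin_ext f (p x))"
  by (induction A rule: infinite_finite_induct) (auto simp: lin_ext_add lin_ext_def[of f 0])

lemma R_Suc_odd:
  assumes "even n"
  shows "(R (Suc n) :: 'a::comm_ring_1 poly) = Delta n (R n)"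
  unfolding R_Suc sum_insertions_odd[OF assms] by (simp add: R_def Delta_def lin_ext_sum)

lemma R_Suc_even:
  assumes "odd n"
  shows "(R (Suc n) :: 'a::comm_ring_1 poly) = Gamma n (R n)"
  unfolding R_Suc sum_insertions_even[OF assms] by (simp add: R_def Gamma_def lin_ext_sum)

lemma R_1: "(R 1 :: 'a::comm_ring_1 poly) = 1"
  by (simp add: R_def desE_def)

theorem theorem3p1:
  shows "(R 1 :: 'a::comm_ring_1 poly) = 1 \<and>
         (R 2 :: 'a poly) = 1 + monom 1 1 \<and>
         (\<forall>n\<ge>1. (R (2 * n + 1) :: 'a poly) = Delta (2 * n) (R (2 * n))) \<and>
         (\<forall>n\<ge>1. (R (2 * n + 2) :: 'a poly) = Gamma (2 * n + 1) (R (2 * n + 1)))"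
proof (intro conjI allI impI)
  show "(R 1 :: 'a poly) = 1"
    by (rule R_1)
  \<comment> \<open>Writing \<open>R 1\<close> as \<open>monom 1 0\<close> lets
    \<open>Gamma_monom\<close> evaluate the step from 1 to 2.\<close>
  have "(R 2 :: 'a poly) = Gamma 1 (monom 1 0)"
    using R_Suc_even[of 1, where 'a = 'a] R_1[where 'a = 'a] by (simp add: numeral_2_eq_2)
  then show "(R 2 :: 'a poly) = 1 + monom 1 1"
    by (simp only: Gamma_monom) simp
  fix n :: nat
  show "(R (2 * n + 1) :: 'a poly) = Delta (2 * n) (R (2 * n))"
    using R_Suc_odd[of "2 * n"] by simp
  show "(R (2 * n + 2) :: 'a poly) = Gamma (2 * n + 1) (R (2 * n + 1))"
    using R_Suc_even[of "2 * n + 1"] by simp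
qed

end
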